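(* Let $\mu$ be a quasi-definite complex Borel measure on $\mathbb T$ and let $l\ge2$. For all non-zero complex $z,z'$ with $z'\bar z\ne1$, the CMV Christoffel--Darboux kernel $K^{[l]}(z,z')=\sum_{k=0}^{l-1}\varphi_1^{(k)}(z')\,\bar\varphi_2^{(k)}(\bar z)$ satisfies $$K^{[l]}(z,z')=\frac{\bar z\,\bar\varphi_{2,+2}^{(l)}(\bar z)\,\varphi_{1,-2}^{(l-1)}(z')-\bar z\,\bar\varphi_{2,-1}^{(l-1)}(\bar z)\,\varphi_{1,+1}^{(l)}(z')}{1-z'\bar z}.$$
   Context: $\mathbb T$ is the unit circle; $\mu$ is quasi-definite if all Toeplitz matrices $\big(\oint_{\mathbb T}z^{i-j}d\mu\big)_{i,j=0}^n$, $n\ge0$, are non-singular. Indices start at $0$; $\dagger$ is the conjugate transpose. For a Laurent polynomial $f=\sum f_kz^k$, $\bar f(z)=\sum\overline{f_k}z^k$ (so $\bar f(\bar z)=\overline{f(z)}$). $\chi(z)=(1,z^{-1},z,z^{-2},z^2,\dots)^\top$ with components $\chi^{(j)}$; $g=\oint_{\mathbb T}\chi\chi^\dagger d\mu=S_1^{-1}S_2$ with $S_1$ lower unitriangular, $S_2$ upper triangular (unique); $\varphi_1^{(l)}=(S_1\chi)^{(l)}$, $\varphi_2^{(l)}=((S_2^{-1})^\dagger\chi)^{(l)}$. $g^{[l]}$ is the leading $l\times l$ block of $g$, $\chi^{[l]}$ the vector of the first $l$ components of $\chi$, $e_0,\dots,e_{l-1}$ the canonical basis of $\mathbb C^l$.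 Associated Laurent polynomials. For $l$ even: $\varphi_{1,+1}^{(l)}=\chi^{(l)}-(g_{l,0},\dots,g_{l,l-1})(g^{[l]})^{-1}\chi^{[l]}$, $\varphi_{1,-2}^{(l-1)}=e_{l-1}^\top(g^{[l]})^{-1}\chi^{[l]}$, $\varphi_{2,+2}^{(l)}=\chi^{(l+1)}-(\bar g_{0,l+1},\dots,\bar g_{l-1,l+1})((g^{[l]})^{-1})^\dagger\chi^{[l]}$, $\varphi_{2,-1}^{(l-1)}=e_{l-2}^\top((g^{[l]})^{-1})^\dagger\chi^{[l]}$. For $l$ odd: $\varphi_{1,+1}^{(l)}=\chi^{(l+1)}-(g_{l+1,0},\dots,g_{l+1,l-1})(g^{[l]})^{-1}\chi^{[l]}$, $\varphi_{1,-2}^{(l-1)}=e_{l-2}^\top(g^{[l]})^{-1}\chi^{[l]}$, $\varphi_{2,+2}^{(l)}=\chi^{(l)}-(\bar g_{0,l},\dots,\bar g_{l-1,l})((g^{[l]})^{-1})^\dagger\chi^{[l]}$, $\varphi_{2,-1}^{(l-1)}=e_{l-1}^\top((g^{[l]})^{-1})^\dagger\chi^{[l]}$. *)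

theory Defs
  imports
    "HOL-Analysis.Analysis"
    "HOL-Library.Poly_Mapping"
    "HOL-Library.Groups_Big_Fun"
    "Jordan_Normal_Form.Schur_Decomposition"
    "Jordan_Normal_Form.Gauss_Jordan_Elimination"
begin

section \<open>Complex measures and integration\<close>

text \<open>
  A complex measure is a countably additive set function \<open>\<mu>\<close> with values in the complex numbers
  on the \<open>\<sigma>\<close>-algebra \<open>sets M\<close>; the measure carried by \<open>M\<close> itself plays no role.  As every
  rearrangement of the sequence \<open>A\<close> is admissible too, the convergence is automatically absolute.
\<close>

definition complex_measure :: "'a measure \<Rightarrow> ('a set \<Rightarrow> complex) \<Rightarrow> bool" where
  "complex_measure M \<mu> \<longleftrightarrow> \<mu> {} = 0 \<and>
     (\<forall>A::nat \<Rightarrow> 'a set. range A \<subseteq> sets M \<and> disjoint_family A \<longrightarrow>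
        (\<lambda>n. \<mu> (A n)) sums \<mu> (\<Union>n. A n))"

text \<open>
  The positive part of the Jordan decomposition of a finite signed measure \<open>\<nu>\<close>,
  \<open>\<nu>\<^sup>+(A) = sup {\<nu>(B) | B \<subseteq> A}\<close>; the negative part is the positive part of \<open>-\<nu>\<close>.
  Truncating negative values to \<open>0\<close> by \<^const>\<open>ennreal\<close> is harmless because \<open>B = {}\<close> is admissible.
\<close>

definition pos_variation :: "'a measure \<Rightarrow> ('a set \<Rightarrow> real) \<Rightarrow> 'a measure" where
  "pos_variation M \<nu> =
     measure_of (space M) (sets M) (\<lambda>A. SUP B\<in>{B \<in> sets M. B \<subseteq> A}. ennreal (\<nu> B))"

definition signed_integral :: "'a measure \<Rightarrow> ('a set \<Rightarrow> real) \<Rightarrow> ('a \<Rightarrow> complex) \<Rightarrow> complex" where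
  "signed_integral M \<nu> f =
     integral\<^sup>L (pos_variation M \<nu>) f - integral\<^sup>L (pos_variation M (\<lambda>A. - \<nu> A)) f"

definition complex_integral :: "'a measure \<Rightarrow> ('a set \<Rightarrow> complex) \<Rightarrow> ('a \<Rightarrow> complex) \<Rightarrow> complex" where
  "complex_integral M \<mu> f =
     signed_integral M (\<lambda>A. Re (\<mu> A)) f + \<i> * signed_integral M (\<lambda>A. Im (\<mu> A)) f"

definition unit_circle :: "complex measure" where
  "unit_circle = restrict_space borel (sphere 0 1)"

abbreviation circle_integral :: "(complex set \<Rightarrow> complex) \<Rightarrow> (complex \<Rightarrow> complex) \<Rightarrow> complex" where
  "circle_integral \<equiv> complex_integral unit_circle"

definition toeplitz_mat :: "(complex set \<Rightarrow> complex) \<Rightarrow> nat \<Rightarrow> complex mat" where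
  "toeplitz_mat \<mu> n =
     mat (n + 1) (n + 1) (\<lambda>(i, j). circle_integral \<mu> (\<lambda>z. z powi (int i - int j)))"

definition quasi_definite :: "(complex set \<Rightarrow> complex) \<Rightarrow> bool" where
  "quasi_definite \<mu> \<longleftrightarrow> (\<forall>n. invertible_mat (toeplitz_mat \<mu> n))"


section \<open>Laurent polynomials\<close>

type_synonym laurent = "int \<Rightarrow>\<^sub>0 complex"

definition leval :: "laurent \<Rightarrow> complex \<Rightarrow> complex" where
  "leval f z = (\<Sum>k\<in>Poly_Mapping.keys f. Poly_Mapping.lookup f k * z powi k)"

definition lscale :: "complex \<Rightarrow> laurent \<Rightarrow> laurent" where
  "lscale c f = Poly_Mapping.map (\<lambda>a. c * a) f"

text \<open>Only the coefficients are conjugated, not the variable.\<close>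

definition lbar :: "laurent \<Rightarrow> laurent" where
  "lbar f = Poly_Mapping.map cnj f"


section \<open>Semi-infinite matrices\<close>

type_synonym inf_mat = "nat \<Rightarrow> nat \<Rightarrow> complex"

text \<open>
  \<^const>\<open>Sum_any\<close> sums over the support of its argument; here it is only relevant where a
  row of the left or a column of the right factor is finitely supported.
\<close>

definition inf_mult :: "inf_mat \<Rightarrow> inf_mat \<Rightarrow> inf_mat" where
  "inf_mult A B = (\<lambda>i j. Sum_any (\<lambda>k. A i k * B k j))"

definition inf_one :: inf_mat where
  "inf_one = (\<lambda>i j. if i = j then 1 else 0)"

definition inf_inverse :: "inf_mat \<Rightarrow> inf_mat" where
  "inf_inverse A = (THE B. inf_mult A B = inf_one \<and> inf_mult B A = inf_one)"

definition inf_adjoint :: "inf_mat \<Rightarrow> inf_mat" where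
  "inf_adjoint A = (\<lambda>i j. cnj (A j i))"

definition inf_mult_lvec :: "inf_mat \<Rightarrow> (nat \<Rightarrow> laurent) \<Rightarrow> nat \<Rightarrow> laurent" where
  "inf_mult_lvec A v = (\<lambda>i. Sum_any (\<lambda>k. lscale (A i k) (v k)))"

definition lower_unitriangular :: "inf_mat \<Rightarrow> bool" where
  "lower_unitriangular A \<longleftrightarrow> (\<forall>i j. i < j \<longrightarrow> A i j = 0) \<and> (\<forall>i. A i i = 1)"

definition inf_upper_triangular :: "inf_mat \<Rightarrow> bool" where
  "inf_upper_triangular A \<longleftrightarrow> (\<forall>i j. j < i \<longrightarrow> A i j = 0)"

definition gauss_factors :: "inf_mat \<Rightarrow> inf_mat \<times> inf_mat" where
  "gauss_factors g = (THE (S1, S2).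
     lower_unitriangular S1 \<and> inf_upper_triangular S2 \<and> g = inf_mult (inf_inverse S1) S2)"


section \<open>CMV ordering, moment matrix and biorthogonal Laurent polynomials\<close>

definition cmv_exponent :: "nat \<Rightarrow> int" where
  "cmv_exponent j = (if even j then int (j div 2) else - int ((j + 1) div 2))"

definition chi :: "nat \<Rightarrow> laurent" where
  "chi j = Poly_Mapping.single (cmv_exponent j) 1"

definition cmv_moment :: "(complex set \<Rightarrow> complex) \<Rightarrow> inf_mat" where
  "cmv_moment \<mu> = (\<lambda>i j. circle_integral \<mu> (\<lambda>z. leval (chi i) z * cnj (leval (chi j) z)))"

definition phi1 :: "(complex set \<Rightarrow> complex) \<Rightarrow> nat \<Rightarrow> laurent" where
  "phi1 \<mu> = inf_mult_lvec (fst (gauss_factors (cmv_moment \<mu>))) chi"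

definition phi2 :: "(complex set \<Rightarrow> complex) \<Rightarrow> nat \<Rightarrow> laurent" where
  "phi2 \<mu> = inf_mult_lvec (inf_adjoint (inf_inverse (snd (gauss_factors (cmv_moment \<mu>))))) chi"

definition cd_kernel :: "(complex set \<Rightarrow> complex) \<Rightarrow> nat \<Rightarrow> complex \<Rightarrow> complex \<Rightarrow> complex" where
  "cd_kernel \<mu> l z z' = (\<Sum>k<l. leval (phi1 \<mu> k) z' * leval (lbar (phi2 \<mu> k)) (cnj z))"


section \<open>Associated Laurent polynomials\<close>

definition moment_block :: "(complex set \<Rightarrow> complex) \<Rightarrow> nat \<Rightarrow> complex mat" where
  "moment_block \<mu> l = mat l l (\<lambda>(i, j). cmv_moment \<mu> i j)"

definition moment_block_inv :: "(complex set \<Rightarrow> complex) \<Rightarrow> nat \<Rightarrow> complex mat" where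
  "moment_block_inv \<mu> l = the (mat_inverse (moment_block \<mu> l))"

text \<open>The Laurent polynomial \<open>v\<^sup>T A \<chi>\<close>, where \<open>\<chi>\<close> is truncated to the number of columns of \<open>A\<close>.\<close>

definition row_mat_chi :: "complex vec \<Rightarrow> complex mat \<Rightarrow> laurent" where
  "row_mat_chi v A = (\<Sum>j<dim_col A. lscale (scalar_prod v (col A j)) (chi j))"

text \<open>
  The argument of each of the following is the superscript of the polynomial.  For
  \<open>phi1_minus2\<close> and \<open>phi2_minus1\<close> that is \<open>m = l - 1\<close>, while the parity distinction and the
  size of the moment block refer to \<open>l\<close>.
\<close>

definition phi1_plus1 :: "(complex set \<Rightarrow> complex) \<Rightarrow> nat \<Rightarrow> laurent" where
  "phi1_plus1 \<mu> l = (let r = (if even l then l else l + 1) in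
     chi r - row_mat_chi (vec l (\<lambda>j. cmv_moment \<mu> r j)) (moment_block_inv \<mu> l))"

definition phi1_minus2 :: "(complex set \<Rightarrow> complex) \<Rightarrow> nat \<Rightarrow> laurent" where
  "phi1_minus2 \<mu> m = (let l = m + 1; r = (if even l then l - 1 else l - 2) in
     row_mat_chi (unit_vec l r) (moment_block_inv \<mu> l))"

definition phi2_plus2 :: "(complex set \<Rightarrow> complex) \<Rightarrow> nat \<Rightarrow> laurent" where
  "phi2_plus2 \<mu> l = (let r = (if even l then l + 1 else l) in
     chi r - row_mat_chi (vec l (\<lambda>i. cnj (cmv_moment \<mu> i r))) (mat_adjoint (moment_block_inv \<mu> l)))"

definition phi2_minus1 :: "(complex set \<Rightarrow> complex) \<Rightarrow> nat \<Rightarrow> laurent" where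
  "phi2_minus1 \<mu> m = (let l = m + 1; r = (if even l then l - 2 else l - 1) in
     row_mat_chi (unit_vec l r) (mat_adjoint (moment_block_inv \<mu> l)))"

end

theory Submission
  imports Defs
begin

text \<open>
  Two facts make the formula true.  Write \<open>g\<close> for the moment matrix, \<open>G\<close> for the inverse of its
  leading \<open>l \<times> l\<close> block, \<open>u = z'\<close> and \<open>w\<close> for the conjugate of \<open>z\<close>.

  First, the kernel does not depend on the factorization: since \<open>S\<^sub>1\<close> is lower and \<open>S\<^sub>2\<close> upper
  triangular, the identity \<open>S\<^sub>1 g = S\<^sub>2\<close> restricts to leading blocks, so the block of
  \<open>S\<^sub>2\<^sup>-\<^sup>1\<close> times the block of \<open>S\<^sub>1\<close> is \<open>G\<close>.  Hence the kernel is the bilinear form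
  \<open>\<Sum> w\<^sup>n G\<^sub>n\<^sub>m u\<^sup>m\<close> in the first \<open>l\<close> CMV exponents (\<open>cd_kernel_eq_block_inverse\<close>).  To use
  this one needs that the Gauss factors and the inverse of \<open>S\<^sub>2\<close> exist and are unique, which
  holds because all leading blocks of \<open>g\<close> are invertible.

  Second, the first \<open>l\<close> CMV exponents fill an interval \<open>{p..q}\<close> of integers, and the entries of
  \<open>g\<close> are the moments \<open>c(m - k)\<close> at differences of exponents.  Sorted by exponent the block is thus a
  Toeplitz matrix; this is why quasi-definiteness gives its invertibility.  The four associated
  polynomials are those attached to the ends of the interval: \<open>\<phi>\<^sub>1\<^sub>,\<^sub>-\<^sub>2\<close> and \<open>\<phi>\<^sub>2\<^sub>,\<^sub>-\<^sub>1\<close> take the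
  row of \<open>G\<close> at \<open>p\<close> and, conjugated, the column at \<open>q\<close>, whereas \<open>\<phi>\<^sub>1\<^sub>,\<^sub>+\<^sub>1\<close> and \<open>\<phi>\<^sub>2\<^sub>,\<^sub>+\<^sub>2\<close> are the monomials with
  exponents \<open>q + 1\<close> and \<open>p - 1\<close> corrected by elements of the span of the block.  In these terms
  the parity of \<open>l\<close> disappears.

  What is left (\<open>toeplitz_christoffel_darboux\<close>) is a reproducing property.  Let \<open>L\<^sub>k\<close> send
  \<open>u\<^sup>m\<close> to \<open>c(m - k)\<close>.  On the span of \<open>u\<^sup>p, \<dots>, u\<^sup>q\<close> the functionals \<open>L\<^sub>p, \<dots>, L\<^sub>q\<close>
  determine an element, and the kernel is the element with values \<open>w\<^sup>k\<close>.  Multiplication by \<open>u\<close>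
  turns \<open>L\<^sub>k\<close> into \<open>L\<^sub>k\<^sub>-\<^sub>1\<close>, so \<open>u w K\<close> has nearly the same values as \<open>K\<close>: it fails only
  by a term \<open>u\<^bsup>q+1\<^esup>\<close> outside the span and by its value under \<open>L\<^sub>p\<close>.  The two products on the right
  hand side repair exactly these two defects.
\<close>

section \<open>Evaluation of Laurent polynomials\<close>

lemma leval_superset:
  assumes "finite A" "Poly_Mapping.keys f \<subseteq> A"
  shows "leval f z = (\<Sum>k\<in>A. Poly_Mapping.lookup f k * z powi k)"
  unfolding leval_def
  by (rule sum.mono_neutral_left) (use assms in \<open>auto simp: in_keys_iff\<close>)

lemma leval_zero [simp]: "leval 0 z = 0"
  by (simp add: leval_def)

lemma leval_add: "leval (f + g) z = leval f z + leval g z"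
proof -
  let ?A = "Poly_Mapping.keys f \<union> Poly_Mapping.keys g"
  have "Poly_Mapping.keys (f + g) \<subseteq> ?A"
    by (rule Poly_Mapping.keys_add)
  then show ?thesis
    by (simp add: leval_superset[of ?A] lookup_add ring_distribs sum.distrib)
qed

lemma leval_diff: "leval (f - g) z = leval f z - leval g z"
  by (metis add_diff_cancel_right' diff_add_cancel leval_add)

lemma leval_sum: "leval (\<Sum>i\<in>I. f i) z = (\<Sum>i\<in>I. leval (f i) z)"
  by (induction I rule: infinite_finite_induct) (simp_all add: leval_add)

lemma leval_lscale: "leval (lscale c f) z = c * leval f z"
proof -
  have lookup: "Poly_Mapping.lookup (lscale c f) k = c * Poly_Mapping.lookup f k" for k
    by (simp add: lscale_def Poly_Mapping.map.rep_eq when_def)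
  have "Poly_Mapping.keys (lscale c f) \<subseteq> Poly_Mapping.keys f"
    by (auto simp: in_keys_iff lookup)
  then show ?thesis
    by (simp add: leval_superset[of "Poly_Mapping.keys f"] lookup sum_distrib_left mult.assoc)
qed

lemma leval_chi: "leval (chi j) z = z powi cmv_exponent j"
  by (simp add: leval_def chi_def)

lemma cnj_power_int: "cnj (z powi k) = cnj z powi k"
  by (simp add: power_int_def)

lemma leval_lbar_cnj: "leval (lbar f) (cnj z) = cnj (leval f z)"
proof -
  have lookup: "Poly_Mapping.lookup (lbar f) k = cnj (Poly_Mapping.lookup f k)" for k
    by (simp add: lbar_def Poly_Mapping.map.rep_eq when_def)
  have "Poly_Mapping.keys (lbar f) \<subseteq> Poly_Mapping.keys f"
    by (auto simp: in_keys_iff lookup)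
  then show ?thesis
    by (simp add: leval_superset[of "Poly_Mapping.keys f"] lookup cnj_power_int)
qed


section \<open>Inversion of triangular semi-infinite matrices\<close>

definition inf_lower_triangular :: "inf_mat \<Rightarrow> bool" where
  "inf_lower_triangular A \<longleftrightarrow> (\<forall>i j. i < j \<longrightarrow> A i j = 0)"

lemma inf_mult_lower:
  assumes "inf_lower_triangular A" "i < n"
  shows "inf_mult A B i j = (\<Sum>k<n. A i k * B k j)"
proof -
  have "A i k = 0" if "\<not> k < n" for k
    using assms that by (simp add: inf_lower_triangular_def)
  then show ?thesis
    unfolding inf_mult_def by (intro Sum_any.expand_superset) auto
qed

lemma inf_mult_upper:
  assumes "inf_upper_triangular B" "j < n"
  shows "inf_mult A B i j = (\<Sum>k<n. A i k * B k j)"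
proof -
  have "B k j = 0" if "\<not> k < n" for k
    using assms that by (simp add: inf_upper_triangular_def)
  then show ?thesis
    unfolding inf_mult_def by (intro Sum_any.expand_superset) auto
qed

lemma sum_inf_one_left: "i < l \<Longrightarrow> (\<Sum>k<l. inf_one i k * x k) = x i"
  by (simp add: inf_one_def if_distrib[of "\<lambda>c. c * _"] cong: if_cong)

lemma sum_inf_one_right: "i < l \<Longrightarrow> (\<Sum>k<l. x k * inf_one k i) = x i"
  by (simp add: inf_one_def if_distrib[of "\<lambda>c. _ * c"] cong: if_cong)

lemma inf_mult_one_left: "inf_mult inf_one A = A"
proof (intro ext)
  fix i j
  have "inf_mult inf_one A i j = (\<Sum>k<Suc i. inf_one i k * A k j)"
    by (rule inf_mult_lower) (auto simp: inf_lower_triangular_def inf_one_def)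
  also have "\<dots> = A i j"
    by (simp add: inf_one_def)
  finally show "inf_mult inf_one A i j = A i j" .
qed

lemma inf_mult_one_right: "inf_mult A inf_one = A"
proof (intro ext)
  fix i j
  have "inf_mult A inf_one i j = (\<Sum>k<Suc j. A i k * inf_one k j)"
    by (rule inf_mult_upper) (auto simp: inf_upper_triangular_def inf_one_def)
  also have "\<dots> = A i j"
    by (simp add: inf_one_def)
  finally show "inf_mult A inf_one i j = A i j" .
qed

lemma inf_lower_triangular_mult:
  assumes A: "inf_lower_triangular A" and B: "inf_lower_triangular B"
  shows "inf_lower_triangular (inf_mult A B)"
  unfolding inf_lower_triangular_def
proof (intro allI impI)
  fix i j :: nat assume "i < j"
  then have "A i k * B k j = 0" if "k < Suc i" for k
    using B that by (simp add: inf_lower_triangular_def)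
  then show "inf_mult A B i j = 0"
    by (subst inf_mult_lower[OF A, of i "Suc i"]) (simp, intro sum.neutral, simp)
qed

lemma inf_mult_assoc_lower:
  assumes A: "inf_lower_triangular A" and B: "inf_lower_triangular B"
  shows "inf_mult A (inf_mult B C) = inf_mult (inf_mult A B) C"
proof (intro ext)
  fix i j
  let ?n = "Suc i"
  have "inf_mult A (inf_mult B C) i j = (\<Sum>k<?n. A i k * inf_mult B C k j)"
    by (rule inf_mult_lower[OF A]) simp
  also have "\<dots> = (\<Sum>k<?n. \<Sum>m<?n. A i k * B k m * C m j)"
    by (intro sum.cong refl)
       (simp add: inf_mult_lower[OF B, of _ ?n] sum_distrib_left mult.assoc del: sum.lessThan_Suc)
  also have "\<dots> = (\<Sum>m<?n. \<Sum>k<?n. A i k * B k m * C m j)"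
    by (rule sum.swap)
  also have "\<dots> = (\<Sum>m<?n. inf_mult A B i m * C m j)"
    by (simp add: inf_mult_lower[OF A, of i ?n] sum_distrib_right del: sum.lessThan_Suc)
  also have "\<dots> = inf_mult (inf_mult A B) C i j"
    by (rule inf_mult_lower[OF inf_lower_triangular_mult[OF A B], symmetric]) simp
  finally show "inf_mult A (inf_mult B C) i j = inf_mult (inf_mult A B) C i j" .
qed

text \<open>
Solving \<open>A B = 1\<close> for the entries of \<open>B\<close> row by row.  The guard \<open>k < i\<close> makes the recursion
well-founded for every \<open>A\<close>.
\<close>

fun forward_substitution :: "inf_mat \<Rightarrow> inf_mat" where
  "forward_substitution A i j =
     (inf_one i j - (\<Sum>k<i. A i k * forward_substitution A k j)) / A i i"

declare forward_substitution.simps [simp del]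

lemma forward_substitution_lower: "i < j \<Longrightarrow> forward_substitution A i j = 0"
proof (induction i rule: less_induct)
  case (less i)
  then have "(\<Sum>k<i. A i k * forward_substitution A k j) = 0"
    by (intro sum.neutral) auto
  with less.prems show ?case
    by (simp add: forward_substitution.simps[of A i j] inf_one_def)
qed

lemma forward_substitution_diagonal: "forward_substitution A i i = 1 / A i i"
  by (simp add: forward_substitution.simps[of A i i] forward_substitution_lower inf_one_def)

lemma forward_substitution_right_inverse:
  assumes A: "inf_lower_triangular A" and diag: "\<And>i. A i i \<noteq> 0"
  shows "inf_mult A (forward_substitution A) = inf_one"
proof (intro ext)
  fix i j
  show "inf_mult A (forward_substitution A) i j = inf_one i j"
    by (simp add: inf_mult_lower[OF A, of i "Suc i"] forward_substitution.simps[of A i j] diag)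
qed

text \<open>
Forward substitution gives a right inverse \<open>B\<close> which is again lower triangular with non-zero
diagonal, hence has itself a right inverse \<open>C\<close>; associativity then forces \<open>A = C\<close>, so \<open>B\<close> is
two-sided.  Associativity is available because only finite sums occur in products of lower
triangular factors with an arbitrary last factor; for this reason uniqueness holds among all
semi-infinite matrices and not only the triangular ones.
\<close>

lemma inf_lower_triangular_two_sided_inverse:
  assumes A: "inf_lower_triangular A" and diag: "\<And>i. A i i \<noteq> 0"
  obtains B where "inf_lower_triangular B" "inf_mult A B = inf_one" "inf_mult B A = inf_one"
    "\<forall>B'. inf_mult A B' = inf_one \<longrightarrow> B' = B"
proof -
  define B where "B = forward_substitution A"
  have B: "inf_lower_triangular B"
    by (simp add: B_def inf_lower_triangular_def forward_substitution_lower)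
  have AB: "inf_mult A B = inf_one"
    unfolding B_def by (rule forward_substitution_right_inverse[OF A diag])
  have B_diag: "B i i \<noteq> 0" for i
    by (simp add: B_def forward_substitution_diagonal diag)
  define C where "C = forward_substitution B"
  have BC: "inf_mult B C = inf_one"
    unfolding C_def by (rule forward_substitution_right_inverse[OF B B_diag])
  have "A = inf_mult A (inf_mult B C)"
    by (simp add: BC inf_mult_one_right)
  also have "\<dots> = C"
    by (simp add: inf_mult_assoc_lower[OF A B] AB inf_mult_one_left)
  finally have BA: "inf_mult B A = inf_one"
    using BC by simp
  have "B' = B" if "inf_mult A B' = inf_one" for B'
  proof -
    have "B' = inf_mult (inf_mult B A) B'"
      by (simp add: BA inf_mult_one_left)
    also have "\<dots> = B"
      using that by (simp add: inf_mult_assoc_lower[OF B A, symmetric] inf_mult_one_right)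
    finally show ?thesis .
  qed
  then show thesis
    using that B AB BA by blast
qed

lemma inf_inverse_lower_triangular:
  assumes A: "inf_lower_triangular A" and diag: "\<And>i. A i i \<noteq> 0"
  shows "inf_lower_triangular (inf_inverse A)"
    and "inf_mult A (inf_inverse A) = inf_one"
    and "inf_mult (inf_inverse A) A = inf_one"
proof -
  obtain B where B: "inf_lower_triangular B"
    and right: "inf_mult A B = inf_one" and left: "inf_mult B A = inf_one"
    and unique: "\<forall>B'. inf_mult A B' = inf_one \<longrightarrow> B' = B"
    using inf_lower_triangular_two_sided_inverse[OF A diag] by blast
  have eq: "inf_inverse A = B"
    unfolding inf_inverse_def
  proof (rule the_equality)
    show "inf_mult A B = inf_one \<and> inf_mult B A = inf_one"
      using right left ..
  next
    fix B' assume "inf_mult A B' = inf_one \<and> inf_mult B' A = inf_one"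
    then show "B' = B"
      using unique by blast
  qed
  show "inf_lower_triangular (inf_inverse A)"
    unfolding eq by (rule B)
  show "inf_mult A (inf_inverse A) = inf_one"
    unfolding eq by (rule right)
  show "inf_mult (inf_inverse A) A = inf_one"
    unfolding eq by (rule left)
qed

text \<open>
Transposition exchanges the order of factors, so this is the lower triangular case for the
transposed matrix.
\<close>

lemma inf_inverse_upper_triangular:
  assumes A: "inf_upper_triangular A" and diag: "\<And>i. A i i \<noteq> 0"
  shows "inf_upper_triangular (inf_inverse A)"
    and "inf_mult (inf_inverse A) A = inf_one"
proof -
  define T :: "inf_mat \<Rightarrow> inf_mat" where "T M = (\<lambda>i j. M j i)" for M
  have T_mult: "inf_mult (T M) (T N) = T (inf_mult N M)" for M N
    by (simp add: T_def inf_mult_def mult.commute)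
  have T_T: "T (T M) = M" and T_one: "T inf_one = inf_one" for M
    by (auto simp: T_def inf_one_def fun_eq_iff)
  have "inf_lower_triangular (T A)" "\<And>i. T A i i \<noteq> 0"
    using A diag by (simp_all add: T_def inf_lower_triangular_def inf_upper_triangular_def)
  then obtain B where B: "inf_lower_triangular B"
    "inf_mult (T A) B = inf_one" "inf_mult B (T A) = inf_one"
    "\<forall>B'. inf_mult (T A) B' = inf_one \<longrightarrow> B' = B"
    using inf_lower_triangular_two_sided_inverse by blast
  have left: "inf_mult (T B) A = inf_one" and right: "inf_mult A (T B) = inf_one"
    using B(2,3) by (metis T_mult T_T T_one)+
  have unique: "B' = T B" if "inf_mult B' A = inf_one" for B'
    using B(4)[rule_format, of "T B'"] that by (metis T_mult T_T T_one)
  have eq: "inf_inverse A = T B"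
    unfolding inf_inverse_def
    by (rule the_equality) (simp_all only: left right unique simp_thms)
  show "inf_upper_triangular (inf_inverse A)"
    using B(1) by (simp add: eq T_def inf_lower_triangular_def inf_upper_triangular_def)
  show "inf_mult (inf_inverse A) A = inf_one"
    by (simp add: eq left)
qed


section \<open>Gauss factorization\<close>

text \<open>
Stated with finite sums over semi-infinite matrices, so that leading blocks can be related to the
Gauss factors without passing to finite matrix types.
\<close>

definition block_inverse :: "inf_mat \<Rightarrow> nat \<Rightarrow> inf_mat \<Rightarrow> bool" where
  "block_inverse g l G \<longleftrightarrow>
     (\<forall>i<l. \<forall>k<l. (\<Sum>j<l. G i j * g j k) = inf_one i k \<and> (\<Sum>j<l. g i j * G j k) = inf_one i k)"

lemma block_inverse_solve:
  assumes G: "block_inverse g l G"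
    and y: "\<And>k. k < l \<Longrightarrow> (\<Sum>j<l. x j * g j k) = y k"
    and i: "i < l"
  shows "x i = (\<Sum>k<l. y k * G k i)"
proof -
  have "(\<Sum>k<l. y k * G k i) = (\<Sum>k<l. \<Sum>j<l. x j * g j k * G k i)"
    by (simp add: y[symmetric] sum_distrib_right)
  also have "\<dots> = (\<Sum>j<l. \<Sum>k<l. x j * g j k * G k i)"
    by (rule sum.swap)
  also have "\<dots> = (\<Sum>j<l. x j * (\<Sum>k<l. g j k * G k i))"
    by (simp add: sum_distrib_left mult.assoc)
  also have "\<dots> = (\<Sum>j<l. x j * inf_one j i)"
    using G i by (simp add: block_inverse_def)
  also have "\<dots> = x i"
    using i by (simp add: sum_inf_one_right)
  finally show ?thesis ..
qed

text \<open>
Uniqueness: row \<open>i\<close> of \<open>S\<^sub>1\<close> has a one at position \<open>i\<close>, and vanishing of \<open>S\<^sub>1 g\<close> below the diagonal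
is a linear system for the remaining entries with the invertible coefficient block of size \<open>i\<close>.
\<close>

lemma gauss_factors_eqI:
  assumes inv: "\<And>l. \<exists>G. block_inverse g l G"
    and S1: "lower_unitriangular S1" and S2: "inf_upper_triangular S2"
    and eq: "inf_mult S1 g = S2"
  shows "gauss_factors g = (S1, S2)"
proof -
  have factor_iff: "g = inf_mult (inf_inverse A) B \<longleftrightarrow> inf_mult A g = B"
    if "lower_unitriangular A" for A B
  proof -
    have A: "inf_lower_triangular A" "\<And>i. A i i \<noteq> 0"
      using that by (auto simp: lower_unitriangular_def inf_lower_triangular_def)
    note inv_A = inf_inverse_lower_triangular[OF A]
    show ?thesis
      by (metis inv_A A(1) inf_mult_assoc_lower inf_mult_one_left)
  qed
  have unique: "A = S1" if A: "lower_unitriangular A" and up: "inf_upper_triangular (inf_mult A g)" for A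
  proof (intro ext)
    fix i j
    obtain G where G: "block_inverse g i G"
      using inv by blast
    have row: "(\<Sum>m<i. M i m * g m k) = - g i k"
      if M: "lower_unitriangular M" "inf_upper_triangular (inf_mult M g)" and "k < i" for M k
    proof -
      have "inf_lower_triangular M"
        using M(1) by (simp add: lower_unitriangular_def inf_lower_triangular_def)
      then have "inf_mult M g i k = (\<Sum>m<Suc i. M i m * g m k)"
        by (rule inf_mult_lower) simp
      then show ?thesis
        using M \<open>k < i\<close>
        by (simp add: lower_unitriangular_def inf_upper_triangular_def add_eq_0_iff)
    qed
    show "A i j = S1 i j"
    proof (cases "j < i")
      case True
      have "A i j = (\<Sum>k<i. - g i k * G k j)"
        by (rule block_inverse_solve[OF G row[OF A up] True])
      also have "\<dots> = S1 i j"
        by (rule block_inverse_solve[OF G row[OF S1] True, symmetric]) (simp add: eq S2)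
      finally show ?thesis .
    next
      case False
      then show ?thesis
        using A S1 by (cases "i = j") (auto simp: lower_unitriangular_def)
    qed
  qed
  show ?thesis
    unfolding gauss_factors_def
  proof (rule the_equality, goal_cases)
    case 1
    show ?case
      using S1 S2 eq by (simp add: factor_iff[OF S1])
  next
    case (2 p)
    obtain A B where p: "p = (A, B)"
      by (cases p)
    have A: "lower_unitriangular A" and B: "inf_upper_triangular B"
      and "g = inf_mult (inf_inverse A) B"
      using 2 by (simp_all add: p)
    then have AB: "inf_mult A g = B"
      using factor_iff[OF A] by blast
    with B have "A = S1"
      by (intro unique[OF A]) simp
    with AB show ?case
      by (simp add: p eq)
  qed
qed

text \<open>
Row \<open>i\<close> of \<open>S\<^sub>1\<close> is the solution of the linear system that makes row \<open>i\<close> of \<open>S\<^sub>1 g\<close> vanish left of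
the diagonal.  The diagonal of \<open>S\<^sub>1 g\<close> cannot vanish, as otherwise row \<open>i\<close> of \<open>S\<^sub>1\<close>, which is not
zero, would be annihilated by the invertible block of size \<open>i + 1\<close>.
\<close>

lemma gauss_factors_exist:
  assumes inv: "\<And>l. \<exists>G. block_inverse g l G"
  obtains S1 S2 where "lower_unitriangular S1" "inf_upper_triangular S2" "inf_mult S1 g = S2"
    "\<forall>i. S2 i i \<noteq> 0"
proof -
  define G where "G l = (SOME G. block_inverse g l G)" for l
  have G: "block_inverse g l (G l)" for l
    unfolding G_def by (rule someI_ex[OF inv])
  define S1 :: inf_mat where
    "S1 = (\<lambda>i j. if j < i then - (\<Sum>m<i. g i m * G i m j) else inf_one i j)"
  define S2 where "S2 = inf_mult S1 g"
  have S1: "lower_unitriangular S1"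
    by (auto simp: S1_def lower_unitriangular_def inf_one_def)
  then have diag_one: "S1 i i = 1" for i
    by (simp add: lower_unitriangular_def)
  from S1 have lower: "inf_lower_triangular S1"
    by (simp add: lower_unitriangular_def inf_lower_triangular_def)
  have upper: "S2 i k = 0" if "k < i" for i k
  proof -
    have "(\<Sum>j<i. S1 i j * g j k) = - (\<Sum>j<i. \<Sum>m<i. g i m * G i m j * g j k)"
      by (simp add: S1_def sum_distrib_right sum_negf)
    also have "\<dots> = - (\<Sum>m<i. \<Sum>j<i. g i m * G i m j * g j k)"
      by (subst sum.swap) simp
    also have "\<dots> = - (\<Sum>m<i. g i m * (\<Sum>j<i. G i m j * g j k))"
      by (simp add: sum_distrib_left mult.assoc)
    also have "\<dots> = - (\<Sum>m<i. g i m * inf_one m k)"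
      using G[of i] that by (simp add: block_inverse_def)
    also have "\<dots> = - g i k"
      using that by (simp add: sum_inf_one_right)
    finally show ?thesis
      by (simp add: S2_def inf_mult_lower[OF lower, of i "Suc i"] diag_one)
  qed
  have diag: "S2 i i \<noteq> 0" for i
  proof
    assume "S2 i i = 0"
    then have row_zero: "(\<Sum>j<Suc i. S1 i j * g j k) = 0" if "k < Suc i" for k
      using upper[of k i] that inf_mult_lower[OF lower, of i "Suc i" g k]
      by (cases "k = i") (auto simp: S2_def)
    have "S1 i i = (\<Sum>k<Suc i. 0 * G (Suc i) k i)"
      by (rule block_inverse_solve[OF G row_zero]) simp_all
    then show False
      by (simp add: S1_def inf_one_def)
  qed
  show thesis
  proof (rule that[OF S1])
    show "inf_upper_triangular S2"
      using upper by (simp add: inf_upper_triangular_def)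
    show "\<forall>i. S2 i i \<noteq> 0"
      using diag by blast
  qed (simp add: S2_def)
qed

text \<open>
Truncation commutes with the products involved: the rows of \<open>S\<^sub>1\<close> with index below \<open>l\<close> and the columns
of \<open>S\<^sub>2\<close> with index below \<open>l\<close> are supported below \<open>l\<close>.
\<close>

lemma block_inverse_via_triangular_factors:
  assumes G: "block_inverse g l G"
    and S1: "inf_lower_triangular S1" and S2: "inf_upper_triangular S2"
    and eq: "inf_mult S1 g = S2" and R: "inf_mult R S2 = inf_one"
    and ij: "i < l" "j < l"
  shows "(\<Sum>k<l. R i k * S1 k j) = G i j"
proof -
  have "(\<Sum>m<l. (\<Sum>k<l. R i k * S1 k m) * g m n) = inf_one i n" if "n < l" for n
  proof -
    have "(\<Sum>m<l. (\<Sum>k<l. R i k * S1 k m) * g m n) = (\<Sum>m<l. \<Sum>k<l. R i k * S1 k m * g m n)"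
      by (simp add: sum_distrib_right)
    also have "\<dots> = (\<Sum>k<l. \<Sum>m<l. R i k * S1 k m * g m n)"
      by (rule sum.swap)
    also have "\<dots> = (\<Sum>k<l. R i k * inf_mult S1 g k n)"
      by (intro sum.cong refl)
         (simp add: inf_mult_lower[OF S1, of _ l] sum_distrib_left mult.assoc)
    also have "\<dots> = inf_mult R S2 i n"
      by (simp add: inf_mult_upper[OF S2 that] eq)
    finally show ?thesis
      by (simp add: R)
  qed
  from block_inverse_solve[OF G this ij(2)] ij(1) show ?thesis
    by (simp add: sum_inf_one_left)
qed


section \<open>The moment matrix\<close>

definition circle_moment :: "(complex set \<Rightarrow> complex) \<Rightarrow> int \<Rightarrow> complex" where
  "circle_moment \<mu> k = circle_integral \<mu> (\<lambda>z. z powi k)"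

text \<open>
The variation measures have the space of \<open>M\<close> whatever the set function is, hence only the values of
the integrand on that space matter.
\<close>

lemma complex_integral_cong:
  assumes "\<And>x. x \<in> space M \<Longrightarrow> f x = g x"
  shows "complex_integral M \<mu> f = complex_integral M \<mu> g"
proof -
  have "space (pos_variation M \<nu>) = space M" for \<nu>
    by (simp add: pos_variation_def space_measure_of sets.space_closed)
  then have "integral\<^sup>L (pos_variation M \<nu>) f = integral\<^sup>L (pos_variation M \<nu>) g" for \<nu>
    using assms by (intro Bochner_Integration.integral_cong) auto
  then show ?thesis
    by (simp add: complex_integral_def signed_integral_def)
qed

text \<open>
On the unit circle conjugation is inversion, so a product of monomials integrates to a power moment.
\<close>

lemma cmv_moment_eq: "cmv_moment \<mu> i j = circle_moment \<mu> (cmv_exponent i - cmv_exponent j)"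
  unfolding cmv_moment_def circle_moment_def
proof (rule complex_integral_cong)
  fix z assume "z \<in> space unit_circle"
  then have "norm z = 1"
    by (simp add: unit_circle_def space_restrict_space)
  then have "z \<noteq> 0" "cnj z = inverse z"
    by (auto simp: complex_norm_square[symmetric] intro!: inverse_unique[symmetric])
  then show "leval (chi i) z * cnj (leval (chi j) z) = z powi (cmv_exponent i - cmv_exponent j)"
    by (simp add: leval_chi cnj_power_int power_int_inverse power_int_diff divide_inverse)
qed

definition cmv_min_exponent :: "nat \<Rightarrow> int" where "cmv_min_exponent l = - int (l div 2)"
definition cmv_max_exponent :: "nat \<Rightarrow> int" where "cmv_max_exponent l = int ((l + 1) div 2) - 1"
definition index_of_exponent :: "int \<Rightarrow> nat" where
  "index_of_exponent k = (if k \<ge> 0 then nat (2 * k) else nat (- 2 * k - 1))"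

lemma index_of_cmv_exponent [simp]: "index_of_exponent (cmv_exponent j) = j"
  by (auto simp: index_of_exponent_def cmv_exponent_def elim!: evenE oddE)

lemma cmv_exponent_of_index [simp]: "cmv_exponent (index_of_exponent k) = k"
  by (auto simp: index_of_exponent_def cmv_exponent_def even_nat_iff)

lemma bij_betw_cmv_exponent: "bij_betw cmv_exponent {..<l} {cmv_min_exponent l..cmv_max_exponent l}"
proof (rule bij_betwI[of _ _ _ index_of_exponent])
  show "cmv_exponent \<in> {..<l} \<rightarrow> {cmv_min_exponent l..cmv_max_exponent l}"
    by (auto simp: cmv_exponent_def cmv_min_exponent_def cmv_max_exponent_def; presburger)
  show "index_of_exponent \<in> {cmv_min_exponent l..cmv_max_exponent l} \<rightarrow> {..<l}"
    by (auto simp: index_of_exponent_def cmv_min_exponent_def cmv_max_exponent_def)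
qed simp_all

lemma mat_mult_eq_one_iff:
  assumes "A \<in> carrier_mat n n" "B \<in> carrier_mat n n"
  shows "A * B = 1\<^sub>m n \<longleftrightarrow>
    (\<forall>i<n. \<forall>k<n. (\<Sum>j<n. A $$ (i, j) * B $$ (j, k)) = (if i = k then 1 else 0))"
  using assms by (auto simp: mat_eq_iff scalar_prod_def lessThan_atLeast0)

text \<open>
The exponents of the first \<open>l\<close> monomials fill an interval, so sorting them turns the leading moment
block into the Toeplitz matrix of size \<open>l\<close>; its inverse only has to be permuted back.
\<close>

lemma cmv_moment_block_invertible:
  assumes "quasi_definite \<mu>"
  shows "\<exists>G. block_inverse (cmv_moment \<mu>) l G"
proof (cases l)
  case 0
  then show ?thesis
    by (simp add: block_inverse_def)
next
  case (Suc n)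
  let ?T = "toeplitz_mat \<mu> n"
  have T: "?T \<in> carrier_mat l l"
    by (simp add: toeplitz_mat_def Suc)
  have "invertible_mat ?T"
    using assms by (simp add: quasi_definite_def)
  then obtain B where TB: "?T * B = 1\<^sub>m l" and BT: "B * ?T = 1\<^sub>m (dim_row B)"
    using T by (auto simp: invertible_mat_def inverts_mat_def)
  have "dim_col B = l"
    using arg_cong[OF TB, of dim_col] by simp
  moreover have "dim_row B = l"
    using arg_cong[OF BT, of dim_col] T by simp
  ultimately have B: "B \<in> carrier_mat l l"
    by auto
  define f where "f j = nat (cmv_exponent j - cmv_min_exponent l)" for j
  have range: "cmv_exponent j \<in> {cmv_min_exponent l..cmv_max_exponent l}" if "j < l" for j
    using bij_betwE[OF bij_betw_cmv_exponent, of l] that by blast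
  have width: "cmv_max_exponent l - cmv_min_exponent l = int l - 1"
    unfolding cmv_max_exponent_def cmv_min_exponent_def by presburger
  have f_eq: "int (f j) = cmv_exponent j - cmv_min_exponent l" if "j < l" for j
    using range[OF that] by (simp add: f_def)
  have f_less: "f j < l" if "j < l" for j
    using f_eq[OF that] range[OF that] width unfolding atLeastAtMost_iff by linarith
  have inj: "inj_on f {..<l}"
    by (rule inj_onI) (metis f_eq index_of_cmv_exponent diff_add_cancel lessThan_iff)
  moreover have "f ` {..<l} = {..<l}"
    by (rule endo_inj_surj[OF _ _ inj]) (auto simp: f_less)
  ultimately have bij: "bij_betw f {..<l} {..<l}"
    by (simp add: bij_betw_def)
  have T_entry: "?T $$ (f i, f j) = cmv_moment \<mu> i j" if "i < l" "j < l" for i j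
    using f_less[OF that(1)] f_less[OF that(2)] f_eq[OF that(1)] f_eq[OF that(2)]
    by (simp add: toeplitz_mat_def Suc cmv_moment_eq circle_moment_def)
  have one: "inf_one i k = (if f i = f k then 1 else 0)" if "i < l" "k < l" for i k
    using inj that by (auto simp: inf_one_def inj_on_def)
  have "block_inverse (cmv_moment \<mu>) l (\<lambda>i j. B $$ (f i, f j))"
    unfolding block_inverse_def
  proof (intro allI impI conjI)
    fix i k assume ik: "i < l" "k < l"
    have "(\<Sum>j<l. B $$ (f i, f j) * cmv_moment \<mu> j k) = (\<Sum>j<l. B $$ (f i, f j) * ?T $$ (f j, f k))"
      using ik by (simp add: T_entry)
    also have "\<dots> = (\<Sum>j<l. B $$ (f i, j) * ?T $$ (j, f k))"
      by (rule sum.reindex_bij_betw[OF bij])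
    also have "\<dots> = inf_one i k"
      using BT B mat_mult_eq_one_iff[OF B T] ik by (auto simp: f_less one)
    finally show "(\<Sum>j<l. B $$ (f i, f j) * cmv_moment \<mu> j k) = inf_one i k" .
    have "(\<Sum>j<l. cmv_moment \<mu> i j * B $$ (f j, f k)) = (\<Sum>j<l. ?T $$ (f i, f j) * B $$ (f j, f k))"
      using ik by (simp add: T_entry)
    also have "\<dots> = (\<Sum>j<l. ?T $$ (f i, j) * B $$ (j, f k))"
      by (rule sum.reindex_bij_betw[OF bij])
    also have "\<dots> = inf_one i k"
      using TB mat_mult_eq_one_iff[OF T B] ik by (auto simp: f_less one)
    finally show "(\<Sum>j<l. cmv_moment \<mu> i j * B $$ (f j, f k)) = inf_one i k" .
  qed
  then show ?thesis
    by (intro exI)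
qed

text \<open>
Gauss--Jordan elimination returns a matrix only for an invertible block, so this is where the value
of \<^const>\<open>moment_block_inv\<close> is seen to be meaningful.
\<close>

lemma moment_block_inv:
  assumes "quasi_definite \<mu>"
  shows moment_block_inv_carrier: "moment_block_inv \<mu> l \<in> carrier_mat l l"
    and block_inverse_moment_block_inv:
      "block_inverse (cmv_moment \<mu>) l (\<lambda>i j. moment_block_inv \<mu> l $$ (i, j))"
proof -
  let ?M = "moment_block \<mu> l"
  have M: "?M \<in> carrier_mat l l"
    by (simp add: moment_block_def)
  obtain G where G: "block_inverse (cmv_moment \<mu>) l G"
    using cmv_moment_block_invertible[OF assms] by blast
  define B where "B = mat l l (\<lambda>(i, j). G i j)"
  have B: "B \<in> carrier_mat l l"
    by (simp add: B_def)
  have "?M * B = 1\<^sub>m l" "B * ?M = 1\<^sub>m l"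
    using G unfolding mat_mult_eq_one_iff[OF M B] mat_mult_eq_one_iff[OF B M]
    by (simp_all add: B_def moment_block_def block_inverse_def inf_one_def)
  then have "?M \<in> Units (ring_mat TYPE(complex) l ())"
    using M B by (auto simp: Units_def ring_mat_simps)
  then obtain C where "mat_inverse ?M = Some C"
    using mat_inverse(1)[OF M] by fastforce
  then have C: "moment_block_inv \<mu> l = C" "?M * C = 1\<^sub>m l" "C * ?M = 1\<^sub>m l" "C \<in> carrier_mat l l"
    using mat_inverse(2)[OF M] by (auto simp: moment_block_inv_def)
  then show "moment_block_inv \<mu> l \<in> carrier_mat l l"
    by simp
  show "block_inverse (cmv_moment \<mu>) l (\<lambda>i j. moment_block_inv \<mu> l $$ (i, j))"
    using C(2,3) mat_mult_eq_one_iff[OF M C(4)] mat_mult_eq_one_iff[OF C(4) M]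
    by (simp add: C(1) block_inverse_def inf_one_def moment_block_def)
qed


section \<open>The kernel in terms of the inverse moment block\<close>

lemma lscale_zero [simp]: "lscale 0 f = 0"
  by (rule poly_mapping_eqI) (simp add: lscale_def Poly_Mapping.map.rep_eq)

lemma leval_inf_mult_lvec_chi:
  assumes "inf_lower_triangular A" "i < l"
  shows "leval (inf_mult_lvec A chi i) z = (\<Sum>j<l. A i j * z powi cmv_exponent j)"
proof -
  have "A i j = 0" if "\<not> j < l" for j
    using assms that by (simp add: inf_lower_triangular_def)
  then have "j < l" if "lscale (A i j) (chi j) \<noteq> 0" for j
    using that by (metis lscale_zero)
  then have "inf_mult_lvec A chi i = (\<Sum>j<l. lscale (A i j) (chi j))"
    unfolding inf_mult_lvec_def by (intro Sum_any.expand_superset) auto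
  then show ?thesis
    by (simp add: leval_sum leval_lscale leval_chi)
qed

lemma cd_kernel_eq_block_inverse:
  assumes "quasi_definite \<mu>" and G: "block_inverse (cmv_moment \<mu>) l G"
  shows "cd_kernel \<mu> l z z' =
    (\<Sum>i<l. \<Sum>j<l. cnj z powi cmv_exponent i * G i j * z' powi cmv_exponent j)"
proof -
  let ?g = "cmv_moment \<mu>"
  let ?w = "\<lambda>i. cnj z powi cmv_exponent i" and ?u = "\<lambda>j. z' powi cmv_exponent j"
  have inv: "\<exists>G. block_inverse ?g n G" for n
    by (rule cmv_moment_block_invertible[OF assms(1)])
  obtain S1 S2 where S: "lower_unitriangular S1" "inf_upper_triangular S2" "inf_mult S1 ?g = S2"
    "\<forall>i. S2 i i \<noteq> 0"
    using gauss_factors_exist[OF inv] by blast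
  define R where "R = inf_inverse S2"
  have factors: "gauss_factors ?g = (S1, S2)"
    by (rule gauss_factors_eqI[OF inv S(1-3)])
  have S1: "inf_lower_triangular S1"
    using S(1) by (simp add: lower_unitriangular_def inf_lower_triangular_def)
  have R: "inf_upper_triangular R" "inf_mult R S2 = inf_one"
    unfolding R_def by (rule inf_inverse_upper_triangular[OF S(2) S(4)[rule_format]])+
  then have R_adj: "inf_lower_triangular (inf_adjoint R)"
    by (simp add: inf_upper_triangular_def inf_lower_triangular_def inf_adjoint_def)
  have phi1: "leval (phi1 \<mu> k) z' = (\<Sum>j<l. S1 k j * ?u j)" if "k < l" for k
    by (simp add: phi1_def factors leval_inf_mult_lvec_chi[OF S1 that])
  have phi2: "leval (lbar (phi2 \<mu> k)) (cnj z) = (\<Sum>i<l. ?w i * R i k)" if "k < l" for k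
  proof -
    have "leval (phi2 \<mu> k) z = (\<Sum>i<l. inf_adjoint R k i * z powi cmv_exponent i)"
      by (simp add: phi2_def factors R_def[symmetric] leval_inf_mult_lvec_chi[OF R_adj that])
    then show ?thesis
      by (simp add: leval_lbar_cnj inf_adjoint_def cnj_power_int mult.commute)
  qed
  have "cd_kernel \<mu> l z z' = (\<Sum>k<l. (\<Sum>i<l. ?w i * R i k) * (\<Sum>j<l. S1 k j * ?u j))"
    unfolding cd_kernel_def by (intro sum.cong refl) (simp add: phi1 phi2 mult.commute)
  also have "\<dots> = (\<Sum>k<l. \<Sum>i<l. \<Sum>j<l. ?w i * (R i k * S1 k j) * ?u j)"
    by (simp add: sum_product mult.assoc)
  also have "\<dots> = (\<Sum>i<l. \<Sum>k<l. \<Sum>j<l. ?w i * (R i k * S1 k j) * ?u j)"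
    by (rule sum.swap)
  also have "\<dots> = (\<Sum>i<l. \<Sum>j<l. \<Sum>k<l. ?w i * (R i k * S1 k j) * ?u j)"
    by (intro sum.cong refl sum.swap)
  also have "\<dots> = (\<Sum>i<l. \<Sum>j<l. ?w i * (\<Sum>k<l. R i k * S1 k j) * ?u j)"
    by (simp only: sum_distrib_left sum_distrib_right)
  also have "\<dots> = (\<Sum>i<l. \<Sum>j<l. ?w i * G i j * ?u j)"
    by (intro sum.cong refl)
       (simp add: block_inverse_via_triangular_factors[OF G S1 S(2,3) R(2)])
  finally show ?thesis .
qed


section \<open>The Christoffel--Darboux formula for Toeplitz matrices\<close>

lemma sum_mult_delta:
  fixes x :: "'i \<Rightarrow> 'a::semiring_1"
  assumes "finite A" "k \<in> A"
  shows "(\<Sum>n\<in>A. x n * (if n = k then 1 else 0)) = x k"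
  using assms by (simp add: if_distrib[of "\<lambda>c. _ * c"] cong: if_cong)

lemma sum_shift_right:
  fixes F :: "int \<Rightarrow> 'a::ab_group_add"
  assumes "p \<le> q"
  shows "(\<Sum>m=p..q. if m = p then 0 else F (m - 1)) = (\<Sum>m=p..q. F m) - F q"
proof -
  have "(\<Sum>m=p..q. if m = p then 0 else F (m - 1)) = (\<Sum>m\<in>{p+1..q}. F (m - 1))"
    by (intro sum.mono_neutral_cong_right) auto
  also have "\<dots> = (\<Sum>m\<in>{p..q-1}. F m)"
    by (rule sum.reindex_bij_witness[of _ "\<lambda>m. m + 1" "\<lambda>m. m - 1"]) auto
  also have "\<dots> = (\<Sum>m=p..q. F m) - F q"
  proof -
    have "{p..q} = insert q {p..q-1}"
      using assms by auto
    then show ?thesis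
      by simp
  qed
  finally show ?thesis .
qed

text \<open>
In the proof, \<open>\<kappa> m\<close> is the coefficient of \<open>u\<^sup>m\<close> in \<open>K\<close>, and \<open>f m\<close> is the coefficient of \<open>u\<^sup>m\<close> in
\<open>w C B - w D A + u w K\<close>.  The latter has no term \<open>u\<^bsup>q+1\<^esup>\<close>, since \<open>D = \<kappa> q\<close> makes the contributions of
\<open>A\<close> and \<open>u w K\<close> cancel.  Both sequences solve the same invertible Toeplitz system, so they agree.
\<close>

lemma toeplitz_christoffel_darboux:
  fixes c :: "int \<Rightarrow> 'a::field" and G :: "int \<Rightarrow> int \<Rightarrow> 'a" and u w :: 'a and p q :: int
  assumes pq: "p \<le> q" and u: "u \<noteq> 0" and w: "w \<noteq> 0"
    and left: "\<And>n k. n \<in> {p..q} \<Longrightarrow> k \<in> {p..q} \<Longrightarrow>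
      (\<Sum>m=p..q. G n m * c (m - k)) = (if n = k then 1 else 0)"
    and right: "\<And>n k. n \<in> {p..q} \<Longrightarrow> k \<in> {p..q} \<Longrightarrow>
      (\<Sum>m=p..q. c (n - m) * G m k) = (if n = k then 1 else 0)"
  defines "K \<equiv> (\<Sum>n=p..q. \<Sum>m=p..q. w powi n * G n m * u powi m)"
    and "A \<equiv> u powi (q + 1) - (\<Sum>m=p..q. (\<Sum>j=p..q. c (q + 1 - j) * G j m) * u powi m)"
    and "B \<equiv> (\<Sum>m=p..q. G p m * u powi m)"
    and "C \<equiv> w powi (p - 1) - (\<Sum>n=p..q. (\<Sum>i=p..q. G n i * c (i - (p - 1))) * w powi n)"
    and "D \<equiv> (\<Sum>n=p..q. G n q * w powi n)"
  shows "(1 - u * w) * K = w * C * B - w * D * A"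
proof -
  define \<kappa> where "\<kappa> m = (\<Sum>n=p..q. w powi n * G n m)" for m
  define a where "a m = (\<Sum>j=p..q. c (q + 1 - j) * G j m)" for m
  define f where
    "f m = w * C * G p m + w * D * a m + (if m = p then 0 else w * \<kappa> (m - 1))" for m
  have K: "K = (\<Sum>m=p..q. \<kappa> m * u powi m)"
    unfolding K_def \<kappa>_def sum_distrib_right by (rule sum.swap)
  have D: "D = \<kappa> q"
    by (simp add: D_def \<kappa>_def mult.commute)
  have \<kappa>_sum: "(\<Sum>m=p..q. \<kappa> m * c (m - k)) =
      (\<Sum>n=p..q. w powi n * (\<Sum>m=p..q. G n m * c (m - k)))" for k
    unfolding \<kappa>_def sum_distrib_left sum_distrib_right mult.assoc by (rule sum.swap)
  have \<kappa>_moment: "(\<Sum>m=p..q. \<kappa> m * c (m - k)) = w powi k" if "k \<in> {p..q}" for k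
    using that by (simp add: \<kappa>_sum left sum_mult_delta del: atLeastAtMost_iff)
  have \<kappa>_moment_below: "(\<Sum>m=p..q. \<kappa> m * c (m - (p - 1))) = w powi (p - 1) - C"
    by (simp add: \<kappa>_sum C_def mult.commute)
  have a_moment: "(\<Sum>m=p..q. a m * c (m - k)) = c (q + 1 - k)" if "k \<in> {p..q}" for k
  proof -
    have "(\<Sum>m=p..q. a m * c (m - k)) =
        (\<Sum>j=p..q. c (q + 1 - j) * (\<Sum>m=p..q. G j m * c (m - k)))"
      unfolding a_def sum_distrib_left sum_distrib_right mult.assoc by (rule sum.swap)
    then show ?thesis
      using that by (simp add: left sum_mult_delta del: atLeastAtMost_iff)
  qed
  (* For y = c(_ - k) this gives the moments of f, for y = u powi _ the value of the polynomial. *)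
  have f_sum: "(\<Sum>m=p..q. f m * y m) = w * C * (\<Sum>m=p..q. G p m * y m)
      + w * D * (\<Sum>m=p..q. a m * y m)
      + w * (\<Sum>m=p..q. \<kappa> m * y (m + 1)) - w * D * y (q + 1)" for y
  proof -
    have "(\<Sum>m=p..q. f m * y m) = w * C * (\<Sum>m=p..q. G p m * y m)
      + w * D * (\<Sum>m=p..q. a m * y m)
      + (\<Sum>m=p..q. if m = p then 0 else w * \<kappa> (m - 1) * y (m - 1 + 1))"
      unfolding f_def sum_distrib_left sum.distrib[symmetric]
      by (intro sum.cong refl) (simp add: algebra_simps)
    also have "(\<Sum>m=p..q. if m = p then 0 else w * \<kappa> (m - 1) * y (m - 1 + 1)) =
        w * (\<Sum>m=p..q. \<kappa> m * y (m + 1)) - w * D * y (q + 1)"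
      by (subst sum_shift_right[OF pq]) (simp add: D sum_distrib_left mult.assoc)
    finally show ?thesis
      by simp
  qed
  have f_moment: "(\<Sum>m=p..q. f m * c (m - k)) = w powi k" if k: "k \<in> {p..q}" for k
  proof -
    have "(\<Sum>m=p..q. f m * c (m - k)) = w * C * (if p = k then 1 else 0) + w * D * c (q + 1 - k)
        + w * (\<Sum>m=p..q. \<kappa> m * c (m + 1 - k)) - w * D * c (q + 1 - k)"
      using k pq by (simp add: f_sum a_moment left)
    also have "(\<Sum>m=p..q. \<kappa> m * c (m + 1 - k)) = (\<Sum>m=p..q. \<kappa> m * c (m - (k - 1)))"
      by (simp add: algebra_simps)
    (* For k = p the shifted functional leaves the block; the defect is the value C. *)
    also have "\<dots> = w powi (k - 1) - (if p = k then C else 0)"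
      using \<kappa>_moment[of "k - 1"] \<kappa>_moment_below k by auto
    finally have "(\<Sum>m=p..q. f m * c (m - k)) = w * w powi (k - 1)"
      by (cases "p = k") (simp_all add: algebra_simps)
    also have "\<dots> = w powi k"
      using power_int_add_1'[of w "k - 1"] w by simp
    finally show ?thesis .
  qed
  have \<kappa>_eq_f: "\<kappa> j = f j" if "j \<in> {p..q}" for j
  proof -
    have "\<kappa> j = (\<Sum>k=p..q. (\<Sum>m=p..q. f m * c (m - k)) * G k j)"
      unfolding \<kappa>_def by (intro sum.cong refl) (simp add: f_moment)
    also have "\<dots> = (\<Sum>m=p..q. f m * (\<Sum>k=p..q. c (m - k) * G k j))"
      unfolding sum_distrib_left sum_distrib_right mult.assoc by (rule sum.swap)
    also have "\<dots> = f j"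
      using that by (simp add: right sum_mult_delta del: atLeastAtMost_iff)
    finally show ?thesis .
  qed
  have "K = (\<Sum>m=p..q. f m * u powi m)"
    unfolding K by (intro sum.cong refl) (simp add: \<kappa>_eq_f)
  also have "\<dots> = w * C * B + w * D * (u powi (q + 1) - A)
      + w * (\<Sum>m=p..q. \<kappa> m * u powi (m + 1)) - w * D * u powi (q + 1)"
    by (simp add: f_sum B_def A_def a_def)
  also have "(\<Sum>m=p..q. \<kappa> m * u powi (m + 1)) = u * K"
    using u by (simp add: K sum_distrib_left power_int_add mult_ac)
  finally show ?thesis
    by (simp add: algebra_simps)
qed


section \<open>The associated Laurent polynomials in monomial coordinates\<close>

lemma leval_row_mat_chi:
  assumes "A \<in> carrier_mat l l"
  shows "leval (row_mat_chi v A) z =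
    (\<Sum>j<l. (\<Sum>i<l. vec_index v i * A $$ (i, j)) * z powi cmv_exponent j)"
  using assms
  by (auto simp: row_mat_chi_def leval_sum leval_lscale leval_chi scalar_prod_def
      lessThan_atLeast0 intro!: sum.cong)

lemma leval_row_mat_chi_unit:
  assumes "A \<in> carrier_mat l l" "r < l"
  shows "leval (row_mat_chi (unit_vec l r) A) z = (\<Sum>j<l. A $$ (r, j) * z powi cmv_exponent j)"
proof -
  have "(\<Sum>i<l. vec_index (unit_vec l r) i * A $$ (i, j)) = A $$ (r, j)" for j
  proof -
    have "(\<Sum>i<l. vec_index (unit_vec l r) i * A $$ (i, j)) =
        (\<Sum>i<l. A $$ (i, j) * (if i = r then 1 else 0))"
      by (intro sum.cong refl) (simp add: unit_vec_def)
    also have "\<dots> = A $$ (r, j)"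
      using assms(2) by (intro sum_mult_delta) auto
    finally show ?thesis .
  qed
  then show ?thesis
    by (simp add: leval_row_mat_chi[OF assms(1)])
qed

lemma mat_adjoint_carrier:
  "A \<in> carrier_mat n n \<Longrightarrow> mat_adjoint A \<in> carrier_mat n n"
  by (auto simp: mat_adjoint_def)

lemma mat_adjoint_index:
  fixes A :: "complex mat"
  assumes "A \<in> carrier_mat n n" "i < n" "j < n"
  shows "mat_adjoint A $$ (i, j) = cnj (A $$ (j, i))"
  using assms by (simp add: mat_adjoint_def mat_of_rows_index)

text \<open>
In each of the four cases the row or column index chosen by the parity of \<open>l\<close> is the one whose
exponent is next to, or at, an end of the exponent interval \<open>{p..q}\<close>: \<open>q + 1\<close>, \<open>p\<close>, \<open>p - 1\<close> and \<open>q\<close>.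
\<close>

lemma leval_phi1_plus1:
  assumes "quasi_definite \<mu>"
  shows "leval (phi1_plus1 \<mu> l) z = z powi (cmv_max_exponent l + 1) -
    (\<Sum>j<l. (\<Sum>i<l. circle_moment \<mu> (cmv_max_exponent l + 1 - cmv_exponent i)
        * moment_block_inv \<mu> l $$ (i, j)) * z powi cmv_exponent j)"
proof -
  let ?r = "if even l then l else l + 1"
  have r: "cmv_exponent ?r = cmv_max_exponent l + 1"
    by (auto simp: cmv_exponent_def cmv_max_exponent_def)
  show ?thesis
    by (simp add: phi1_plus1_def Let_def leval_diff leval_chi cmv_moment_eq r
        leval_row_mat_chi[OF moment_block_inv_carrier[OF assms]] del: of_nat_Suc)
qed

lemma leval_phi1_minus2:
  assumes "quasi_definite \<mu>" "l \<ge> 2"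
  shows "leval (phi1_minus2 \<mu> (l - 1)) z =
    (\<Sum>j<l. moment_block_inv \<mu> l $$ (index_of_exponent (cmv_min_exponent l), j) * z powi cmv_exponent j)"
proof -
  let ?r = "if even l then l - 1 else l - 2"
  have "cmv_exponent ?r = cmv_min_exponent l"
    using assms(2) by (auto simp: cmv_exponent_def cmv_min_exponent_def elim!: evenE oddE)
  then have r: "?r = index_of_exponent (cmv_min_exponent l)"
    using index_of_cmv_exponent by metis
  have "?r < l"
    using assms(2) by auto
  then show ?thesis
    using assms(2) unfolding r[symmetric]
    by (simp add: phi1_minus2_def Let_def
        leval_row_mat_chi_unit[OF moment_block_inv_carrier[OF assms(1)]])
qed

lemma leval_phi2_plus2:
  assumes "quasi_definite \<mu>"
  shows "leval (lbar (phi2_plus2 \<mu> l)) (cnj z) = cnj z powi (cmv_min_exponent l - 1) -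
    (\<Sum>j<l. (\<Sum>i<l. moment_block_inv \<mu> l $$ (j, i)
        * circle_moment \<mu> (cmv_exponent i - (cmv_min_exponent l - 1))) * cnj z powi cmv_exponent j)"
proof -
  let ?r = "if even l then l + 1 else l"
  have r: "cmv_exponent ?r = cmv_min_exponent l - 1"
    by (auto simp: cmv_exponent_def cmv_min_exponent_def elim!: evenE oddE)
  note G = moment_block_inv_carrier[OF assms, of l]
  show ?thesis
    unfolding leval_lbar_cnj phi2_plus2_def Let_def leval_diff leval_chi cmv_moment_eq r
      leval_row_mat_chi[OF mat_adjoint_carrier[OF G]]
    by (simp add: mat_adjoint_index[OF G] cnj_power_int mult.commute)
qed

lemma leval_phi2_minus1:
  assumes "quasi_definite \<mu>" "l \<ge> 2"
  shows "leval (lbar (phi2_minus1 \<mu> (l - 1))) (cnj z) =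
    (\<Sum>j<l. moment_block_inv \<mu> l $$ (j, index_of_exponent (cmv_max_exponent l)) * cnj z powi cmv_exponent j)"
proof -
  let ?r = "if even l then l - 2 else l - 1"
  have "cmv_exponent ?r = cmv_max_exponent l"
    using assms(2) by (auto simp: cmv_exponent_def cmv_max_exponent_def elim!: evenE oddE)
  then have r: "?r = index_of_exponent (cmv_max_exponent l)"
    using index_of_cmv_exponent by metis
  note G = moment_block_inv_carrier[OF assms(1), of l]
  have "?r < l"
    using assms(2) by auto
  then show ?thesis
    using assms(2) unfolding r[symmetric]
    by (simp add: phi2_minus1_def Let_def leval_lbar_cnj
        leval_row_mat_chi_unit[OF mat_adjoint_carrier[OF G]] mat_adjoint_index[OF G] cnj_power_int)
qed

lemma sum_cmv_exponents: "(\<Sum>m=cmv_min_exponent l..cmv_max_exponent l. F m) = (\<Sum>j<l. F (cmv_exponent j))"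
  by (rule sum.reindex_bij_betw[OF bij_betw_cmv_exponent, symmetric])

text \<open>
  With \<open>w\<close> the conjugate of \<open>z\<close>, the four evaluated polynomials are the quantities \<open>A\<close>, \<open>B\<close>, \<open>C\<close> and \<open>D\<close>
  of the Toeplitz formula once sums over indices are rewritten as sums over exponents.
\<close>

theorem theorem4:
  fixes \<mu> :: "complex set \<Rightarrow> complex" and l :: nat and z z' :: complex
  assumes "complex_measure unit_circle \<mu>"
    and "quasi_definite \<mu>"
    and "l \<ge> 2"
    and "z \<noteq> 0" and "z' \<noteq> 0"
    and "z' * cnj z \<noteq> 1"
  shows "cd_kernel \<mu> l z z' =
    (cnj z * leval (lbar (phi2_plus2 \<mu> l)) (cnj z) * leval (phi1_minus2 \<mu> (l - 1)) z'
     - cnj z * leval (lbar (phi2_minus1 \<mu> (l - 1))) (cnj z) * leval (phi1_plus1 \<mu> l) z')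
    / (1 - z' * cnj z)"
proof -
  define G where "G n m = moment_block_inv \<mu> l $$ (index_of_exponent n, index_of_exponent m)" for n m
  let ?I = "{cmv_min_exponent l..cmv_max_exponent l}"
  note block = block_inverse_moment_block_inv[OF assms(2), of l]
  have index: "index_of_exponent n < l" if "n \<in> ?I" for n
    using that by (auto simp: index_of_exponent_def cmv_min_exponent_def cmv_max_exponent_def)
  have one: "inf_one (index_of_exponent n) (index_of_exponent k) = (if n = k then 1 else 0)" for n k
    by (metis inf_one_def cmv_exponent_of_index)
  have left: "(\<Sum>m\<in>?I. G n m * circle_moment \<mu> (m - k)) = (if n = k then 1 else 0)"
    if "n \<in> ?I" "k \<in> ?I" for n k
  proof -
    have "(\<Sum>j<l. moment_block_inv \<mu> l $$ (index_of_exponent n, j) * cmv_moment \<mu> j (index_of_exponent k)) =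
        inf_one (index_of_exponent n) (index_of_exponent k)"
      using block index[OF that(1)] index[OF that(2)] by (simp add: block_inverse_def)
    then show ?thesis
      by (simp add: sum_cmv_exponents G_def cmv_moment_eq one)
  qed
  have right: "(\<Sum>m\<in>?I. circle_moment \<mu> (n - m) * G m k) = (if n = k then 1 else 0)"
    if "n \<in> ?I" "k \<in> ?I" for n k
  proof -
    have "(\<Sum>j<l. cmv_moment \<mu> (index_of_exponent n) j * moment_block_inv \<mu> l $$ (j, index_of_exponent k)) =
        inf_one (index_of_exponent n) (index_of_exponent k)"
      using block index[OF that(1)] index[OF that(2)] by (simp add: block_inverse_def)
    then show ?thesis
      by (simp add: sum_cmv_exponents G_def cmv_moment_eq one)
  qed
  have range: "cmv_min_exponent l \<le> cmv_max_exponent l"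
    using assms(3) by (simp add: cmv_min_exponent_def cmv_max_exponent_def)
  have "(1 - z' * cnj z) * cd_kernel \<mu> l z z' =
    cnj z * leval (lbar (phi2_plus2 \<mu> l)) (cnj z) * leval (phi1_minus2 \<mu> (l - 1)) z'
     - cnj z * leval (lbar (phi2_minus1 \<mu> (l - 1))) (cnj z) * leval (phi1_plus1 \<mu> l) z'"
    unfolding cd_kernel_eq_block_inverse[OF assms(2) block] leval_phi1_plus1[OF assms(2)]
      leval_phi2_plus2[OF assms(2)] leval_phi1_minus2[OF assms(2,3)]
      leval_phi2_minus1[OF assms(2,3)]
    using toeplitz_christoffel_darboux[OF range assms(5) _ left right, of "cnj z"] assms(4)
    by (simp add: sum_cmv_exponents G_def)
  then show ?thesis
    using assms(6) by (simp add: eq_divide_eq mult.commute)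
qed

end
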